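(* Let $\mathcal C\subset\mathbb{RP}^2$ be a non-degenerate isogonal cubic with spiral center $P$ and real point at infinity $P_\infty$. Let $X\in\mathcal C$ be a non-singular point and let $X'$ be its isogonal conjugate with respect to $\mathcal C$. Let $\ell$ be the isogonal of the line $XX'$ with respect to the lines $XP,XP_\infty$, i.e. the line through $X$ such that $(XX',\ell)$ and $(XP,XP_\infty)$ are isogonal. Then $\ell$ is tangent to $\mathcal C$ at $X$.
   Context: A cubic is non-degenerate if it is irreducible. Two pairs of lines through a point $X\in\mathbb R^2$ are isogonal if they have the same pair of angle bisectors; two pairs of parallel lines (through a common real point at infinity) are isogonal if they have the same midline. For distinct $A,B,C,D\in\mathbb R^2$, the isogonal cubic of $ABCD$ is the locus of points $X\in\mathbb{RP}^2$ for which $(XA,XC)$ and $(XB,XD)$ are isogonal; identifying $\mathbb R^2$ with the complex plane, with lower-case letters for complex coordinates, its equation is $(x-b)(x-d)\,\overline{(x-a)(x-c)}=\overline{(x-b)(x-d)}\,(x-a)(x-c)$, completed projectively. An isogonal cubic is a cubic that is the isogonal cubic of some such $ABCD$. A non-degenerate isogonal cubic has exactly one real point at infinity, denoted $P_\infty$. The spiral center of $ABCD$ is the center of the spiral similarity taking $A\mapsto B$, $D\mapsto C$, i.e. the unique point $P$ with $(a-p)(c-p)=(b-p)(d-p)$. Points $X,X'$ are isogonal conjugates in $ABCD$ if $(AX,AX')$ and $(AB,AD)$ are isogonal and the analogous condition holds at the vertices $B,C,D$. Every $X\in\mathcal C$ has a unique isogonal conjugate in $ABCD$, lying on $\mathcal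 C$. The spiral center and the isogonal conjugate of a point depend only on $\mathcal C$, not on the choice of $ABCD$ having $\mathcal C$ as isogonal cubic, and are called the spiral center of $\mathcal C$ and the isogonal conjugate with respect to $\mathcal C$; $P$ lies on $\mathcal C$, and $P$ and $P_\infty$ are isogonal conjugates. Convention: for $U\in\mathcal C$, $UU$ denotes the tangent to $\mathcal C$ at $U$. *)

theory Defs
  imports "HOL-Analysis.Analysis" "HOL-Computational_Algebra.Polynomial_Factorial"
begin

text \<open>The real projective plane, with homogeneous coordinates \<open>(z, w)\<close> in
  \<open>\<complex> \<times> \<real>\<close>, so that \<open>\<real>\<^sup>2\<close> is identified with the complex plane: the affine point
  \<open>z\<close> is \<open>(z : 1)\<close>, and \<open>(u : 0)\<close> is the point at infinity of the lines with direction \<open>u\<close>.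
  The term \<open>pt v\<close> is meaningful only for \<open>v \<noteq> 0\<close>.\<close>

quotient_type rp2 = "complex \<times> real" / partial:
    "\<lambda>u v. u \<noteq> 0 \<and> v \<noteq> 0 \<and> (\<exists>k::real. v = k *\<^sub>R u)"
  morphisms rep_rp2 pt
proof (rule part_equivpI)
  show "\<exists>v::complex \<times> real. v \<noteq> 0 \<and> v \<noteq> 0 \<and> (\<exists>k::real. v = k *\<^sub>R v)"
    by (rule exI[of _ "(0, 1)"]) (auto simp: zero_prod_def intro: exI[of _ 1])
  show "symp (\<lambda>u v::complex \<times> real. u \<noteq> 0 \<and> v \<noteq> 0 \<and> (\<exists>k::real. v = k *\<^sub>R u))"
  proof (rule sympI, elim conjE exE, intro conjI)
    fix u v :: "complex \<times> real" and k :: real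
    assume "u \<noteq> 0" "v \<noteq> 0" "v = k *\<^sub>R u"
    then have "u = inverse k *\<^sub>R v" by auto
    then show "\<exists>k. u = k *\<^sub>R v" ..
  qed
  show "transp (\<lambda>u v::complex \<times> real. u \<noteq> 0 \<and> v \<noteq> 0 \<and> (\<exists>k::real. v = k *\<^sub>R u))"
    by (rule transpI) (metis scaleR_scaleR)
qed

definition fin :: "complex \<Rightarrow> rp2" where
  "fin z = pt (z, 1)"

definition line_at_infinity :: "rp2 set" where
  "line_at_infinity = {pt (u, 0) | u. u \<noteq> 0}"

definition line_through :: "rp2 \<Rightarrow> rp2 \<Rightarrow> rp2 set" where
  "line_through U V = {pt y | u v y. u \<noteq> 0 \<and> v \<noteq> 0 \<and> y \<noteq> 0 \<and>
     U = pt u \<and> V = pt v \<and> y \<in> span {u, v}}"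

definition is_line :: "rp2 set \<Rightarrow> bool" where
  "is_line L \<longleftrightarrow> (\<exists>U V. U \<noteq> V \<and> L = line_through U V)"

definition affine_part :: "rp2 set \<Rightarrow> complex set" where
  "affine_part L = {z. fin z \<in> L}"

text \<open>For lines \<open>l\<close>, \<open>m\<close> through the affine point \<open>x\<close>: the line \<open>n\<close> through \<open>x\<close> with direction
  \<open>u\<close> is an angle bisector of \<open>l\<close> and \<open>m\<close> if the reflection in \<open>n\<close> takes \<open>l\<close> to \<open>m\<close>. There are
  always two such lines, perpendicular to each other (for \<open>l = m\<close>: the line \<open>l\<close> and its
  perpendicular at \<open>x\<close>).\<close>

definition angle_bisector :: "complex \<Rightarrow> rp2 set \<Rightarrow> rp2 set \<Rightarrow> rp2 set \<Rightarrow> bool" where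
  "angle_bisector x l m n \<longleftrightarrow>
     (\<exists>u. u \<noteq> 0 \<and> n = line_through (fin x) (pt (u, 0)) \<and>
          (\<lambda>z. x + u / cnj u * cnj (z - x)) ` affine_part l = affine_part m)"

text \<open>Only used for parallel affine lines.\<close>

definition midline :: "rp2 set \<Rightarrow> rp2 set \<Rightarrow> complex set" where
  "midline l m = {midpoint y z | y z. y \<in> affine_part l \<and> z \<in> affine_part m}"

text \<open>\<open>isogonal X l l' m m'\<close>: the pairs \<open>(l, l')\<close> and \<open>(m, m')\<close> of lines through \<open>X\<close> are
  isogonal.\<close>

definition isogonal :: "rp2 \<Rightarrow> rp2 set \<Rightarrow> rp2 set \<Rightarrow> rp2 set \<Rightarrow> rp2 set \<Rightarrow> bool" where
  "isogonal X l l' m m' \<longleftrightarrow>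
     (\<forall>k \<in> {l, l', m, m'}. is_line k \<and> k \<noteq> line_at_infinity \<and> X \<in> k) \<and>
     ((\<exists>x. X = fin x \<and> {n. angle_bisector x l l' n} = {n. angle_bisector x m m' n}) \<or>
      (X \<in> line_at_infinity \<and> midline l l' = midline m m'))"

text \<open>A plane projective curve is given by its form, a homogeneous polynomial in
  \<open>\<real>[x, y, w]\<close>. In the type \<^typ>\<open>real poly poly poly\<close> the innermost variable is
  \<open>x = Re z\<close>, the middle one \<open>y = Im z\<close>, and the outermost one \<open>w\<close>.\<close>

type_synonym form = "real poly poly poly"

definition homogeneous :: "nat \<Rightarrow> form \<Rightarrow> bool" where
  "homogeneous d F \<longleftrightarrow>
     (\<forall>i j k. coeff (coeff (coeff F k) j) i \<noteq> 0 \<longrightarrow> i + j + k = d)"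

definition evalf :: "form \<Rightarrow> complex \<times> real \<Rightarrow> real" where
  "evalf F v = poly (poly (poly F [:[:snd v:]:]) [:Im (fst v):]) (Re (fst v))"

definition curve :: "form \<Rightarrow> rp2 set" where
  "curve F = {pt v | v. v \<noteq> 0 \<and> evalf F v = 0}"

definition singular_point :: "form \<Rightarrow> rp2 \<Rightarrow> bool" where
  "singular_point F U \<longleftrightarrow> U \<in> curve F \<and>
     (\<exists>u. u \<noteq> 0 \<and> U = pt u \<and> frechet_derivative (evalf F) (at u) = (\<lambda>_. 0))"

text \<open>The tangent at a non-singular point \<open>U\<close> of the curve.\<close>

definition tangent_line :: "form \<Rightarrow> rp2 \<Rightarrow> rp2 set" where
  "tangent_line F U = {pt y | u y. u \<noteq> 0 \<and> y \<noteq> 0 \<and> U = pt u \<and>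
     frechet_derivative (evalf F) (at u) y = 0}"

text \<open>The line \<open>UV\<close>, with the convention that \<open>UU\<close> is the tangent at \<open>U\<close>.\<close>

definition chord :: "form \<Rightarrow> rp2 \<Rightarrow> rp2 \<Rightarrow> rp2 set" where
  "chord F U V = (if U = V then tangent_line F U else line_through U V)"

text \<open>The difference of the two sides of the equation of the isogonal cubic of \<open>ABCD\<close> has
  degree at most 3 in \<open>Re x\<close>, \<open>Im x\<close>, the terms of degree 4 cancelling. A cubic form \<open>F\<close>
  defines the projective completion if its dehomogenization is this difference up to a nonzero
  constant (which is imaginary, since \<open>F\<close> is real).\<close>

definition isogonal_cubic_of ::
    "complex \<Rightarrow> complex \<Rightarrow> complex \<Rightarrow> complex \<Rightarrow> form \<Rightarrow> bool" where
  "isogonal_cubic_of a b c d F \<longleftrightarrow>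
     distinct [a, b, c, d] \<and> homogeneous 3 F \<and>
     (\<exists>\<kappa>::complex. \<kappa> \<noteq> 0 \<and> (\<forall>x. complex_of_real (evalf F (x, 1)) =
        \<kappa> * ((x - b) * (x - d) * cnj ((x - a) * (x - c))
             - cnj ((x - b) * (x - d)) * ((x - a) * (x - c)))))"

definition isogonal_cubic :: "form \<Rightarrow> bool" where
  "isogonal_cubic F \<longleftrightarrow> (\<exists>a b c d. isogonal_cubic_of a b c d F)"

definition spiral_center :: "form \<Rightarrow> rp2 \<Rightarrow> bool" where
  "spiral_center F P \<longleftrightarrow> (\<exists>a b c d p. isogonal_cubic_of a b c d F \<and> P = fin p \<and>
     (a - p) * (c - p) = (b - p) * (d - p))"

definition isogonal_conjugates_in ::
    "complex \<Rightarrow> complex \<Rightarrow> complex \<Rightarrow> complex \<Rightarrow> form \<Rightarrow> rp2 \<Rightarrow> rp2 \<Rightarrow> bool" where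
  "isogonal_conjugates_in a b c d F X X' \<longleftrightarrow>
     isogonal (fin a) (chord F (fin a) X) (chord F (fin a) X')
       (line_through (fin a) (fin b)) (line_through (fin a) (fin d)) \<and>
     isogonal (fin b) (chord F (fin b) X) (chord F (fin b) X')
       (line_through (fin b) (fin c)) (line_through (fin b) (fin a)) \<and>
     isogonal (fin c) (chord F (fin c) X) (chord F (fin c) X')
       (line_through (fin c) (fin d)) (line_through (fin c) (fin b)) \<and>
     isogonal (fin d) (chord F (fin d) X) (chord F (fin d) X')
       (line_through (fin d) (fin a)) (line_through (fin d) (fin c))"

definition isogonal_conjugates :: "form \<Rightarrow> rp2 \<Rightarrow> rp2 \<Rightarrow> bool" where
  "isogonal_conjugates F X X' \<longleftrightarrow> (\<exists>a b c d. isogonal_cubic_of a b c d F \<and>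
     isogonal_conjugates_in a b c d F X X')"

end

theory Submission
  imports Defs
begin

text \<open>Put the spiral center at the origin, so that \<open>ac = bd = m\<close>, and let \<open>\<sigma> = a + c - b - d\<close>. The
  cubic is then \<open>Im (\<sigma> cnj (\<xi> + m / \<xi>)) = k\<close> with \<open>k\<close> real; its real point at infinity has direction
  \<open>\<sigma>\<close>, and the isogonal conjugate of \<open>\<xi>\<close> is \<open>\<xi>' = m / \<xi>\<close>. Differentiating, the tangent at \<open>\<xi>\<close> has
  direction \<open>\<sigma> / (1 - m / \<xi>\<^sup>2) = \<sigma> \<xi> / (\<xi> - \<xi>')\<close>, so the product of the directions of \<open>XX'\<close> and of
  the tangent is a real multiple of the product \<open>\<xi> \<sigma>\<close> of the directions of \<open>XP\<close> and \<open>XP\<^sub>\<infinity>\<close>. The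
  isogonality conditions at the vertices determine the conjugate unless \<open>A, B, C, D\<close> are collinear,
  in which case the cubic contains their line and is reducible.\<close>

subsection \<open>Lines and isogonality\<close>

lemma Im_mult_cnj_eq_0_iff: "Im (u * cnj v) = 0 \<longleftrightarrow> u / v \<in> \<real>"
proof (cases "v = 0")
  case False
  have "u / v = of_real (1 / (cmod v)\<^sup>2) * (u * cnj v)"
    by (simp add: complex_div_cnj[of u v])
  then have "Im (u / v) = Im (u * cnj v) / (cmod v)\<^sup>2" by simp
  then show ?thesis using False by (simp add: complex_is_Real_iff)
qed auto

lemma pt_eq_iff:
  assumes "u \<noteq> 0" "v \<noteq> 0"
  shows "pt u = pt v \<longleftrightarrow> (\<exists>k. k \<noteq> 0 \<and> v = k *\<^sub>R u)"
proof -
  have refl: "\<exists>k. w = k *\<^sub>R w" for w :: "complex \<times> real"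
    by (rule exI[of _ 1]) simp
  have "pt u = pt v \<longleftrightarrow> (\<exists>k. v = k *\<^sub>R u)"
    using Quotient_rel[OF Quotient_rp2, of u v] assms refl by simp
  then show ?thesis using assms(2) by auto
qed

lemma pt_surj: obtains u where "u \<noteq> 0" "U = pt u"
  using Quotient_abs_rep[OF Quotient_rp2, of U] Quotient_rep_reflp[OF Quotient_rp2, of U] that
  by fastforce

lemma pt_scale: "u \<noteq> 0 \<Longrightarrow> k \<noteq> 0 \<Longrightarrow> pt (k *\<^sub>R u) = pt u"
  by (subst eq_commute, subst pt_eq_iff) auto

lemma fin_inject: "fin x = fin y \<longleftrightarrow> x = y"
  by (auto simp: fin_def pt_eq_iff zero_prod_def)

lemma fin_neq_infinity: "u \<noteq> 0 \<Longrightarrow> fin x \<noteq> pt (u, 0)"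
  by (simp add: fin_def pt_eq_iff zero_prod_def)

lemma fin_notin_infinity: "fin x \<notin> line_at_infinity"
  using fin_neq_infinity by (auto simp: line_at_infinity_def)

lemma rp2_cases:
  obtains x where "U = fin x" | u where "u \<noteq> 0" "U = pt (u, 0)"
proof -
  obtain v where v: "v \<noteq> 0" "U = pt v" by (rule pt_surj)
  obtain z w where zw: "v = (z, w)" by (cases v)
  show ?thesis
  proof (cases "w = 0")
    case True
    then show ?thesis using v zw that(2)[of z] by (simp add: zero_prod_def)
  next
    case False
    then have "U = fin ((1/w) *\<^sub>R z)"
      using v zw pt_scale[of v "1/w"] by (simp add: fin_def)
    then show ?thesis by (rule that(1))
  qed
qed

lemma line_through_pt:
  assumes "u \<noteq> 0" "v \<noteq> 0"
  shows "line_through (pt u) (pt v) = {pt y | y. y \<noteq> 0 \<and> y \<in> span {u, v}}"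
proof -
  have "span {u', v'} \<subseteq> span {u, v}"
    if uv': "u' \<noteq> 0" "v' \<noteq> 0" "pt u = pt u'" "pt v = pt v'" for u' v'
  proof -
    obtain k l where "u' = k *\<^sub>R u" "v' = l *\<^sub>R v"
      using uv' pt_eq_iff[OF assms(1) uv'(1)] pt_eq_iff[OF assms(2) uv'(2)] by blast
    then show ?thesis by (intro span_minimal) (auto intro: span_scale span_base)
  qed
  then show ?thesis unfolding line_through_def using assms by blast
qed

lemma line_through_commute: "line_through U V = line_through V U"
proof -
  obtain u v where "u \<noteq> 0" "U = pt u" "v \<noteq> 0" "V = pt v" by (metis pt_surj)
  then show ?thesis by (simp add: line_through_pt insert_commute)
qed

lemma mem_span_pair: "y \<in> span {u, v} \<longleftrightarrow> (\<exists>s t. y = s *\<^sub>R u + t *\<^sub>R v)"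
  for y :: "'a :: real_vector"
proof -
  have "y \<in> span {u, v} \<longleftrightarrow> (\<exists>s t. y - s *\<^sub>R u = t *\<^sub>R v)"
    by (auto simp: span_insert span_singleton)
  then show ?thesis by (simp add: diff_eq_eq add.commute)
qed

lemma line_through_exchange:
  assumes "W \<in> line_through U V" "W \<noteq> V"
  shows "line_through U V = line_through W V"
proof -
  obtain u v where uv: "u \<noteq> 0" "U = pt u" "v \<noteq> 0" "V = pt v" by (metis pt_surj)
  then obtain w where w: "w \<noteq> 0" "W = pt w" "w \<in> span {u, v}"
    using assms(1) by (auto simp: line_through_pt)
  then obtain s t where st: "w = s *\<^sub>R u + t *\<^sub>R v" by (auto simp: mem_span_pair)
  have "s \<noteq> 0"
  proof
    assume "s = 0"
    then have "w = t *\<^sub>R v" "t \<noteq> 0" using st w(1) by auto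
    then have "pt w = pt v" using uv(3) by (simp add: pt_scale)
    then show False using assms(2) w uv by simp
  qed
  then have u: "u = (1 / s) *\<^sub>R w + (- t / s) *\<^sub>R v" using st by (simp add: algebra_simps)
  have "span {u, v} = span {w, v}"
  proof (rule antisym)
    have "u \<in> span {w, v}" using u by (auto simp only: mem_span_pair)
    then show "span {u, v} \<subseteq> span {w, v}"
      by (intro span_minimal) (auto intro: span_base)
    show "span {w, v} \<subseteq> span {u, v}"
      using w(3) by (intro span_minimal) (auto intro: span_base)
  qed
  then show ?thesis using uv w by (simp add: line_through_pt)
qed

definition line_dir :: "complex \<Rightarrow> complex \<Rightarrow> rp2 set" where
  "line_dir x u = {pt y | y. y \<noteq> 0 \<and> (fst y - of_real (snd y) * x) / u \<in> \<real>}"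

lemma pt_in_line_dir:
  assumes "y \<noteq> 0"
  shows "pt y \<in> line_dir x u \<longleftrightarrow> (fst y - of_real (snd y) * x) / u \<in> \<real>"
proof -
  have "(fst y' - of_real (snd y') * x) / u \<in> \<real> \<longleftrightarrow> (fst y - of_real (snd y) * x) / u \<in> \<real>"
    if y': "y' \<noteq> 0" "pt y = pt y'" for y'
  proof -
    obtain k where k: "k \<noteq> 0" "y' = k *\<^sub>R y" using y' pt_eq_iff[OF assms y'(1)] by blast
    have eq: "(fst y' - of_real (snd y') * x) / u = of_real k * ((fst y - of_real (snd y) * x) / u)"
      using k by (simp add: scaleR_conv_of_real algebra_simps diff_divide_distrib)
    show ?thesis unfolding eq complex_is_Real_iff
      using k(1) by (simp del: times_divide_eq_right)
  qed
  then show ?thesis using assms unfolding line_dir_def by blast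
qed

lemma fin_in_line_dir: "fin z \<in> line_dir x u \<longleftrightarrow> (z - x) / u \<in> \<real>"
  by (simp add: fin_def pt_in_line_dir zero_prod_def)

lemma line_dir_cong:
  assumes "u / v \<in> \<real>" "u \<noteq> 0" "v \<noteq> 0"
  shows "line_dir x u = line_dir x v"
proof -
  have "d / u \<in> \<real> \<longleftrightarrow> d / v \<in> \<real>" for d
  proof
    assume "d / u \<in> \<real>"
    then have "d / u * (u / v) \<in> \<real>" using assms(1) by (rule Reals_mult)
    then show "d / v \<in> \<real>" using assms by simp
  next
    assume "d / v \<in> \<real>"
    then have "d / v / (u / v) \<in> \<real>" using assms(1) by (rule Reals_divide)
    then show "d / u \<in> \<real>" using assms by simp
  qed
  then show ?thesis by (simp add: line_dir_def)
qed

lemma line_through_fin: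
  assumes "y \<noteq> 0" "fst y - of_real (snd y) * x \<noteq> 0"
  shows "line_through (fin x) (pt y) = line_dir x (fst y - of_real (snd y) * x)"
proof -
  let ?d = "\<lambda>y. fst y - of_real (snd y) * x"
  have "v \<in> span {(x, 1), y} \<longleftrightarrow> ?d v / ?d y \<in> \<real>" for v
  proof
    assume "v \<in> span {(x, 1), y}"
    then obtain s t where "v = s *\<^sub>R (x, 1) + t *\<^sub>R y" by (auto simp: mem_span_pair)
    then have "?d v = of_real t * ?d y"
      by (simp add: scaleR_conv_of_real algebra_simps)
    then show "?d v / ?d y \<in> \<real>" using assms(2) by simp
  next
    assume "?d v / ?d y \<in> \<real>"
    then obtain t where "?d v / ?d y = of_real t" by (auto elim: Reals_cases)
    then have "?d v = of_real t * ?d y" using assms(2) by (simp add: field_simps)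
    then have "v = (snd v - t * snd y) *\<^sub>R (x, 1) + t *\<^sub>R y"
      by (simp add: prod_eq_iff scaleR_conv_of_real algebra_simps)
    then show "v \<in> span {(x, 1), y}" by (auto simp only: mem_span_pair)
  qed
  then show ?thesis using assms(1)
    by (simp add: fin_def line_through_pt zero_prod_def line_dir_def)
qed

lemma line_through_fin_infinity:
  "u \<noteq> 0 \<Longrightarrow> line_through (fin x) (pt (u, 0)) = line_dir x u"
  using line_through_fin[of "(u, 0)" x] by (simp add: zero_prod_def)

lemma line_through_fin_fin:
  "z \<noteq> x \<Longrightarrow> line_through (fin x) (fin z) = line_dir x (z - x)"
  using line_through_fin[of "(z, 1)" x] by (simp add: zero_prod_def fin_def)

lemma line_through_eq_line_dir:
  assumes "V \<noteq> fin x"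
  obtains u where "u \<noteq> 0" "line_through (fin x) V = line_dir x u"
proof (cases V rule: rp2_cases)
  case (1 z)
  then show ?thesis using assms that[of "z - x"] by (auto simp: line_through_fin_fin)
next
  case (2 u)
  then show ?thesis using that[of u] by (simp add: line_through_fin_infinity)
qed

lemma is_line_fin:
  assumes "is_line L" "fin x \<in> L"
  obtains u where "u \<noteq> 0" "L = line_dir x u"
proof -
  obtain U V where UV: "U \<noteq> V" "L = line_through U V"
    using assms(1) by (auto simp: is_line_def)
  obtain W where "W \<noteq> fin x" "L = line_through (fin x) W"
  proof (cases "fin x = V")
    case True
    then show ?thesis using that[of U] UV by (simp add: line_through_commute)
  next
    case False
    then show ?thesis using that[of V] UV line_through_exchange assms(2) by metis
  qed
  then show ?thesis using line_through_eq_line_dir that by metis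
qed

lemma line_through_infinity:
  assumes "pt (u, 0) \<noteq> pt (v, 0)" "u \<noteq> 0" "v \<noteq> 0"
  shows "line_through (pt (u, 0)) (pt (v, 0)) = line_at_infinity"
proof -
  have nr: "Im (u * cnj v) \<noteq> 0"
  proof
    assume "Im (u * cnj v) = 0"
    then obtain r where r: "u / v = of_real r" unfolding Im_mult_cnj_eq_0_iff by (rule Reals_cases)
    then have "(u, 0::real) = r *\<^sub>R (v, 0)" using assms(3) by (simp add: scaleR_conv_of_real field_simps)
    moreover have "r \<noteq> 0" using r assms by auto
    ultimately show False using assms pt_scale[of "(v, 0)" r] by (simp add: zero_prod_def)
  qed
  have "y \<in> span {(u, 0), (v, 0)} \<longleftrightarrow> snd y = 0" for y :: "complex \<times> real"
  proof
    assume "snd y = 0"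
    moreover define s where "s = Im (fst y * cnj v) / Im (u * cnj v)"
    moreover define t where "t = Im (u * cnj (fst y)) / Im (u * cnj v)"
    moreover have "Im (u * cnj v) *\<^sub>R fst y = Im (fst y * cnj v) *\<^sub>R u + Im (u * cnj (fst y)) *\<^sub>R v"
      by (simp add: complex_eq_iff algebra_simps)
    then have "fst y = (1 / Im (u * cnj v)) *\<^sub>R (Im (fst y * cnj v) *\<^sub>R u + Im (u * cnj (fst y)) *\<^sub>R v)"
      using nr by (metis divide_self_if scaleR_one scaleR_scaleR times_divide_eq_left mult_1)
    ultimately have "y = s *\<^sub>R (u, 0) + t *\<^sub>R (v, 0)"
      by (simp add: prod_eq_iff scaleR_right_distrib)
    then show "y \<in> span {(u, 0), (v, 0)}" by (auto simp only: mem_span_pair)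
  qed (auto simp: mem_span_pair)
  then show ?thesis using assms
    by (auto simp add: line_through_pt zero_prod_def line_at_infinity_def)
qed

lemma is_line_infinity:
  assumes "is_line L" "L \<noteq> line_at_infinity" "pt (s, 0) \<in> L" "s \<noteq> 0"
  obtains e where "L = line_dir e s"
proof -
  obtain U V where UV: "U \<noteq> V" "L = line_through U V"
    using assms(1) by (auto simp: is_line_def)
  obtain e W where eW: "W \<noteq> fin e" "L = line_through (fin e) W"
  proof (cases U rule: rp2_cases)
    case (1 x)
    then show ?thesis using UV that by metis
  next
    case (2 u)
    show ?thesis
    proof (cases V rule: rp2_cases)
      case (1 x)
      then show ?thesis using UV that line_through_commute by metis
    next
      case (2 v)
      then show ?thesis
        using \<open>U = pt (u, 0)\<close> \<open>u \<noteq> 0\<close> UV assms(2) line_through_infinity by metis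
    qed
  qed
  then obtain u where u: "u \<noteq> 0" "L = line_dir e u" by (metis line_through_eq_line_dir)
  then have "s / u \<in> \<real>"
    using assms(3,4) pt_in_line_dir[of "(s, 0)" e u] by (simp add: zero_prod_def)
  then show ?thesis using that u assms(4) line_dir_cong by metis
qed

lemma affine_part_line_dir:
  assumes "u \<noteq> 0"
  shows "affine_part (line_dir x u) = range (\<lambda>t. x + of_real t * u)"
proof -
  have "(z - x) / u \<in> \<real> \<longleftrightarrow> (\<exists>t. z = x + of_real t * u)" for z
    using assms by (auto simp: Reals_def field_simps)
  then show ?thesis by (auto simp: affine_part_def fin_in_line_dir)
qed

lemma line_dir_eqD:
  assumes "line_dir x u = line_dir x v" "u \<noteq> 0"
  shows "u / v \<in> \<real>"
  using assms fin_in_line_dir[of "x + u" x u] fin_in_line_dir[of "x + u" x v] by simp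

lemma angle_bisector_line_dir:
  assumes "u \<noteq> 0" "v \<noteq> 0"
  shows "angle_bisector x (line_dir x u) (line_dir x v) n \<longleftrightarrow>
    (\<exists>w. w \<noteq> 0 \<and> n = line_dir x w \<and> w\<^sup>2 / (u * v) \<in> \<real>)"
proof -
  have "(\<lambda>z. x + w / cnj w * cnj (z - x)) ` affine_part (line_dir x u) = affine_part (line_dir x v)
      \<longleftrightarrow> w\<^sup>2 / (u * v) \<in> \<real>" if "w \<noteq> 0" for w
  proof -
    let ?u = "w / cnj w * cnj u"
    have "?u \<noteq> 0" using assms that by simp
    have img: "(\<lambda>z. x + w / cnj w * cnj (z - x)) ` affine_part (line_dir x u) = affine_part (line_dir x ?u)"
      unfolding affine_part_line_dir[OF \<open>?u \<noteq> 0\<close>] affine_part_line_dir[OF assms(1)]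
      by (simp add: image_image mult_ac)
    have same: "affine_part (line_dir x ?u) = affine_part (line_dir x v) \<longleftrightarrow> ?u / v \<in> \<real>"
    proof
      assume "affine_part (line_dir x ?u) = affine_part (line_dir x v)"
      moreover have "x + ?u \<in> affine_part (line_dir x ?u)"
        using \<open>?u \<noteq> 0\<close> by (simp add: affine_part_def fin_in_line_dir)
      ultimately have "x + ?u \<in> affine_part (line_dir x v)" by simp
      then show "?u / v \<in> \<real>" by (simp add: affine_part_def fin_in_line_dir)
    next
      assume "?u / v \<in> \<real>"
      then show "affine_part (line_dir x ?u) = affine_part (line_dir x v)"
        using line_dir_cong[of ?u v x] \<open>?u \<noteq> 0\<close> assms by simp
    qed
    have eq: "?u / v = of_real ((cmod u)\<^sup>2 / (cmod w)\<^sup>2) * (w\<^sup>2 / (u * v))"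
      unfolding of_real_divide complex_norm_square
      using assms that by (simp add: power2_eq_square)
    show ?thesis unfolding img same eq complex_is_Real_iff
      using assms(1) that by (simp del: times_divide_eq_right of_real_divide of_real_power)
  qed
  then show ?thesis unfolding angle_bisector_def
    using line_through_fin_infinity by metis
qed

lemma isogonal_line_dir:
  assumes "isogonal (fin x) (line_dir x u) (line_dir x u') (line_dir x v) (line_dir x v')"
    and "u \<noteq> 0" "u' \<noteq> 0" "v \<noteq> 0" "v' \<noteq> 0"
  shows "(u * u') / (v * v') \<in> \<real>"
proof -
  have eq: "{n. angle_bisector x (line_dir x u) (line_dir x u') n} =
      {n. angle_bisector x (line_dir x v) (line_dir x v') n}"
    using assms(1) fin_notin_infinity by (auto simp: isogonal_def fin_inject)
  define w where "w = csqrt (u * u')"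
  have w: "w\<^sup>2 = u * u'" "w \<noteq> 0" using assms by (auto simp: w_def)
  then have "angle_bisector x (line_dir x u) (line_dir x u') (line_dir x w)"
    using assms by (subst angle_bisector_line_dir) auto
  then have "angle_bisector x (line_dir x v) (line_dir x v') (line_dir x w)"
    using eq by blast
  then obtain w' where w': "w' \<noteq> 0" "line_dir x w = line_dir x w'" "w'\<^sup>2 / (v * v') \<in> \<real>"
    using assms by (subst (asm) angle_bisector_line_dir) auto
  then have "(w / w')\<^sup>2 * (w'\<^sup>2 / (v * v')) \<in> \<real>"
    using line_dir_eqD[OF w'(2) w(2)] by (intro Reals_mult Reals_power)
  then show ?thesis using w w' by (simp add: power_divide)
qed

lemma midline_line_dir:
  assumes "s \<noteq> 0"
  shows "z \<in> midline (line_dir e s) (line_dir e' s) \<longleftrightarrow> (z - midpoint e e') / s \<in> \<real>"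
proof -
  have "z \<in> midline (line_dir e s) (line_dir e' s) \<longleftrightarrow>
    (\<exists>t t'. z = midpoint (e + of_real t * s) (e' + of_real t' * s))"
    unfolding midline_def affine_part_line_dir[OF assms] by blast
  also have "\<dots> \<longleftrightarrow> (z - midpoint e e') / s \<in> \<real>"
  proof
    assume "\<exists>t t'. z = midpoint (e + of_real t * s) (e' + of_real t' * s)"
    then obtain t t' where "z = midpoint (e + of_real t * s) (e' + of_real t' * s)" by blast
    then have "(z - midpoint e e') / s = of_real ((t + t') / 2)"
      using assms by (simp add: midpoint_def scaleR_conv_of_real field_simps)
    then show "(z - midpoint e e') / s \<in> \<real>" by (metis Reals_of_real)
  next
    assume "(z - midpoint e e') / s \<in> \<real>"
    then obtain t where "(z - midpoint e e') / s = of_real t" by (auto elim: Reals_cases)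
    then have "z = midpoint (e + of_real t * s) (e' + of_real t * s)"
      using assms by (simp add: midpoint_def scaleR_conv_of_real field_simps)
    then show "\<exists>t t'. z = midpoint (e + of_real t * s) (e' + of_real t' * s)" by blast
  qed
  finally show ?thesis .
qed

lemma line_dir_base_cong:
  assumes "(e - e') / s \<in> \<real>"
  shows "line_dir e s = line_dir e' s"
proof -
  have "(z - of_real w * e) / s \<in> \<real> \<longleftrightarrow> (z - of_real w * e') / s \<in> \<real>" for z w
  proof -
    have "(z - of_real w * e') / s = (z - of_real w * e) / s + of_real w * ((e - e') / s)"
      by (simp add: diff_divide_distrib algebra_simps)
    moreover have "of_real w * ((e - e') / s) \<in> \<real>" using assms by (intro Reals_mult) auto
    ultimately show ?thesis by (metis Reals_add Reals_diff add_diff_cancel_right')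
  qed
  then show ?thesis by (simp add: line_dir_def)
qed

lemma midline_cancel:
  assumes "midline (line_dir e s) (line_dir f s) = midline (line_dir e s) (line_dir g s)" "s \<noteq> 0"
  shows "line_dir f s = line_dir g s"
proof (rule line_dir_base_cong)
  have "midpoint e f \<in> midline (line_dir e s) (line_dir g s)"
    unfolding assms(1)[symmetric] using assms(2) by (simp add: midline_line_dir)
  then have "(midpoint e f - midpoint e g) / s \<in> \<real>" using assms(2) by (simp add: midline_line_dir)
  moreover have "(f - g) / s = of_real 2 * ((midpoint e f - midpoint e g) / s)"
    using assms(2) by (simp add: midpoint_def scaleR_conv_of_real field_simps)
  ultimately show "(f - g) / s \<in> \<real>" by (metis Reals_mult Reals_of_real)
qed

subsection \<open>Evaluation of forms\<close>

lemma evalf_add: "evalf (F + G) v = evalf F v + evalf G v"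
  and evalf_diff: "evalf (F - G) v = evalf F v - evalf G v"
  and evalf_mult: "evalf (F * G) v = evalf F v * evalf G v"
  and evalf_one: "evalf 1 v = 1"
  by (simp_all add: evalf_def)

lemma evalf_const: "evalf [:[:[:r:]:]:] v = r"
  and evalf_x: "evalf [:[:[:0, 1:]:]:] v = Re (fst v)"
  and evalf_y: "evalf [:[:0, 1:]:] v = Im (fst v)"
  and evalf_w: "evalf [:0, 1:] v = snd v"
  by (simp_all add: evalf_def)

lemma evalf_altdef:
  "evalf F v = (\<Sum>k\<le>degree F. \<Sum>j\<le>degree (coeff F k). \<Sum>i\<le>degree (coeff (coeff F k) j).
     coeff (coeff (coeff F k) j) i * Re (fst v) ^ i * Im (fst v) ^ j * snd v ^ k)"
proof -
  have "evalf F v = (\<Sum>k\<le>degree F. poly (poly (coeff F k) [:Im (fst v):]) (Re (fst v)) * snd v ^ k)"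
    unfolding evalf_def poly_altdef[of F]
    by (simp add: poly_sum)
  also have "\<dots> = (\<Sum>k\<le>degree F. \<Sum>j\<le>degree (coeff F k).
      poly (coeff (coeff F k) j) (Re (fst v)) * Im (fst v) ^ j * snd v ^ k)"
    unfolding poly_altdef[of "coeff F k" for k] by (simp add: poly_sum sum_distrib_right)
  finally show ?thesis by (simp only: poly_altdef[of "coeff (coeff F k) j" for k j] sum_distrib_right)
qed

lemma evalf_homogeneous:
  assumes "homogeneous d F"
  shows "evalf F (t *\<^sub>R v) = t ^ d * evalf F v"
proof -
  have "coeff (coeff (coeff F k) j) i * Re (fst (t *\<^sub>R v)) ^ i * Im (fst (t *\<^sub>R v)) ^ j * snd (t *\<^sub>R v) ^ k
    = t ^ d * (coeff (coeff (coeff F k) j) i * Re (fst v) ^ i * Im (fst v) ^ j * snd v ^ k)" for i j k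
  proof (cases "coeff (coeff (coeff F k) j) i = 0")
    case False
    then have "d = i + j + k" using assms unfolding homogeneous_def by metis
    then show ?thesis by (simp add: power_mult_distrib power_add)
  qed simp
  then show ?thesis unfolding evalf_altdef sum_distrib_left by (simp only:)
qed

lemma continuous_evalf: "continuous_on A (evalf F)"
  unfolding evalf_altdef[abs_def] by (intro continuous_intros)

lemma form_eq_0I:
  assumes "\<And>z w. w \<noteq> 0 \<Longrightarrow> evalf F (z, w) = 0"
  shows "F = 0"
proof -
  have inf: "infinite (UNIV - {0::real})" by (simp add: infinite_UNIV_char_0)
  have 1: "poly (poly F [:[:w:]:]) [:y:] = 0" if "w \<noteq> 0" for w y
    by (rule poly_all_0_iff_0[THEN iffD1])
      (use assms[OF that, of "Complex _ y"] in \<open>simp add: evalf_def\<close>)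
  have 2: "poly F [:[:w:]:] = 0" if "w \<noteq> 0" for w
  proof (rule ccontr)
    assume "poly F [:[:w:]:] \<noteq> 0"
    then have "finite {x. poly (poly F [:[:w:]:]) x = 0}" by (rule poly_roots_finite)
    moreover have "range (\<lambda>y. [:y:]) \<subseteq> {x. poly (poly F [:[:w:]:]) x = 0}" using 1 that by auto
    ultimately have "finite (range (\<lambda>y::real. [:y:]))" by (rule finite_subset[rotated])
    then have "finite (UNIV :: real set)" by (rule finite_imageD) (simp add: inj_on_def)
    then show False by (simp add: infinite_UNIV_char_0)
  qed
  show ?thesis
  proof (rule ccontr)
    assume "F \<noteq> 0"
    then have "finite {x. poly F x = 0}" by (rule poly_roots_finite)
    moreover have "(\<lambda>w. [:[:w:]:]) ` (UNIV - {0}) \<subseteq> {x. poly F x = 0}" using 2 by auto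
    ultimately have "finite ((\<lambda>w::real. [:[:w:]:]) ` (UNIV - {0}))" by (rule finite_subset[rotated])
    then have "finite (UNIV - {0 :: real})" by (rule finite_imageD) (simp add: inj_on_def)
    then show False using inf by simp
  qed
qed

lemma not_unit_form:
  assumes "evalf F v = 0"
  shows "\<not> F dvd 1"
proof
  assume "F dvd 1"
  then obtain G where "1 = F * G" by (auto elim: dvdE)
  then have "1 = evalf F v * evalf G v" by (metis evalf_mult evalf_one)
  then show False using assms by simp
qed

subsection \<open>The cubic and its spiral center\<close>

lemma isogonal_equation:
  fixes x p :: complex
  defines "X \<equiv> x - p"
  shows "(x - b) * (x - d) * cnj ((x - a) * (x - c)) - cnj ((x - b) * (x - d)) * ((x - a) * (x - c))
   = of_real (2 * Im (((a + c - b - d) * X + ((b - p) * (d - p) - (a - p) * (c - p))) *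
         cnj (X\<^sup>2 - (a + c - 2 * p) * X + (a - p) * (c - p)))) * \<i>"
proof -
  have q: "(x - b) * (x - d) = ((a + c - b - d) * X + ((b - p) * (d - p) - (a - p) * (c - p))) + (x - a) * (x - c)"
    by (simp add: X_def algebra_simps)
  have r: "X\<^sup>2 - (a + c - 2 * p) * X + (a - p) * (c - p) = (x - a) * (x - c)"
    by (simp add: X_def algebra_simps power2_eq_square)
  have *: "(u + v) * cnj v - cnj (u + v) * v = of_real (2 * Im (u * cnj v)) * \<i>" for u v
    by (simp add: complex_eq_iff algebra_simps)
  show ?thesis unfolding r q * ..
qed

lemma spiral_center_unique:
  assumes "isogonal_cubic_of a b c d F" "spiral_center F (fin p)"
  shows "(a - p) * (c - p) = (b - p) * (d - p)"
proof -
  define f where "f a b c d x = (x - b) * (x - d) * cnj ((x - a) * (x - c))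
      - cnj ((x - b) * (x - d)) * ((x - a) * (x - c))" for a b c d x
  \<comment> \<open>this second difference isolates the harmonic part of the quadratic terms of \<open>f\<close>, which
    vanishes exactly if \<open>p\<close> is the spiral center\<close>
  define D where "D g t = g (p + t) + g (p - t) - g (p + \<i> * t) - g (p - \<i> * t)" for g :: "complex \<Rightarrow> complex" and t
  have G: "(u * t + v) * cnj (t\<^sup>2 - s * t + n) + (u * (- t) + v) * cnj ((- t)\<^sup>2 - s * (- t) + n)
      - (u * (\<i> * t) + v) * cnj ((\<i> * t)\<^sup>2 - s * (\<i> * t) + n)
      - (u * (- (\<i> * t)) + v) * cnj ((- (\<i> * t))\<^sup>2 - s * (- (\<i> * t)) + n)
      = 4 * (v * cnj (t\<^sup>2))" for u v s n t
    by (simp add: algebra_simps power2_eq_square)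
  have D: "D (f a b c d) t = of_real (8 * Im (((b - p) * (d - p) - (a - p) * (c - p)) * cnj (t\<^sup>2))) * \<i>" for a b c d t
  proof -
    define g where "g y = Im (((a + c - b - d) * y + ((b - p) * (d - p) - (a - p) * (c - p))) *
         cnj (y\<^sup>2 - (a + c - 2 * p) * y + (a - p) * (c - p)))" for y
    have f: "f a b c d (p + y) = of_real (2 * g y) * \<i>" for y
      unfolding f_def isogonal_equation[where p = p] g_def add_diff_cancel_left' ..
    have "g t + g (- t) - g (\<i> * t) - g (- (\<i> * t)) =
        Im (4 * (((b - p) * (d - p) - (a - p) * (c - p)) * cnj (t\<^sup>2)))"
      using arg_cong[OF G[of "a + c - b - d" t "(b - p) * (d - p) - (a - p) * (c - p)" "a + c - 2 * p" "(a - p) * (c - p)"], of Im]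
      unfolding g_def plus_complex.sel(2) minus_complex.sel(2) .
    then have "2 * g t + 2 * g (- t) - 2 * g (\<i> * t) - 2 * g (- (\<i> * t)) =
        8 * Im (((b - p) * (d - p) - (a - p) * (c - p)) * cnj (t\<^sup>2))" by simp
    then show ?thesis
      unfolding D_def diff_conv_add_uminus[of p] f
      by (simp only: left_diff_distrib[symmetric] distrib_right[symmetric] of_real_add[symmetric] of_real_diff[symmetric])
  qed
  obtain a' b' c' d' where q': "isogonal_cubic_of a' b' c' d' F" "(a' - p) * (c' - p) = (b' - p) * (d' - p)"
    using assms(2) by (auto simp: spiral_center_def fin_inject)
  obtain k where k: "k \<noteq> 0" "\<And>x. complex_of_real (evalf F (x, 1)) = k * f a b c d x"
    using assms(1) unfolding isogonal_cubic_of_def f_def by blast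
  obtain k' where k': "\<And>x. complex_of_real (evalf F (x, 1)) = k' * f a' b' c' d' x"
    using q'(1) unfolding isogonal_cubic_of_def f_def by blast
  have "k * D (f a b c d) t = k' * D (f a' b' c' d') t" for t
    unfolding D_def right_diff_distrib distrib_left k(2)[symmetric] k'[symmetric] ..
  then have "D (f a b c d) t = 0" for t using k(1) q'(2) D[of a' b' c' d'] by simp
  then have "Im (((b - p) * (d - p) - (a - p) * (c - p)) * cnj (t\<^sup>2)) = 0" for t
    unfolding D by (metis of_real_eq_0_iff mult_eq_0_iff complex_i_not_zero zero_neq_numeral)
  from this[of 1] this[of "1 + \<i>"] show ?thesis
    by (simp add: complex_eq_iff power2_eq_square)
qed

text \<open>With the spiral center \<open>p\<close> as origin, both quadratics have the constant term \<open>m\<close>, and they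
  differ by \<open>\<sigma> \<xi>\<close>.\<close>

locale centered_cubic =
  fixes F :: form and p \<sigma> m :: complex and k c0 :: real
  assumes c0: "c0 \<noteq> 0" and \<sigma>: "\<sigma> \<noteq> 0" and m: "m \<noteq> 0"
    and evalf_eq: "evalf F v = c0 * ((cmod (fst v - of_real (snd v) * p))\<^sup>2 *
       (Im (\<sigma> * cnj (fst v - of_real (snd v) * p)) - k * snd v) +
       (snd v)\<^sup>2 * Im (\<sigma> * cnj m * (fst v - of_real (snd v) * p)))"

lemma centered_cubicI:
  assumes "isogonal_cubic_of a b c d F" "(a - p) * (c - p) = (b - p) * (d - p)"
  obtains c0 where "centered_cubic F p (a + c - b - d) ((a - p) * (c - p)) (Im ((a + c - b - d) * cnj (a + c - 2 * p))) c0"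
proof -
  define \<sigma> m s where "\<sigma> = a + c - b - d" and "m = (a - p) * (c - p)" and "s = a + c - 2 * p"
  define k where "k = Im (\<sigma> * cnj s)"
  have dist: "distinct [a, b, c, d]" and hom: "homogeneous 3 F"
    using assms(1) by (auto simp: isogonal_cubic_of_def)
  obtain \<kappa> where \<kappa>: "\<kappa> \<noteq> 0" "\<And>x. complex_of_real (evalf F (x, 1)) =
     \<kappa> * ((x - b) * (x - d) * cnj ((x - a) * (x - c)) - cnj ((x - b) * (x - d)) * ((x - a) * (x - c)))"
    using assms(1) unfolding isogonal_cubic_of_def by blast
  define h where "h x = (cmod x)\<^sup>2 * (Im (\<sigma> * cnj x) - k) + Im (\<sigma> * cnj m * x)" for x
  have "Im (\<sigma> * (x - p) * cnj ((x - p)\<^sup>2 - s * (x - p) + m)) = h (x - p)" for x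
    unfolding h_def k_def cmod_power2 by (simp add: algebra_simps power2_eq_square)
  then have ev: "complex_of_real (evalf F (x, 1)) = \<kappa> * (of_real (2 * h (x - p)) * \<i>)" for x
    unfolding \<kappa>(2) isogonal_equation[where p = p] using assms(2) by (simp add: \<sigma>_def m_def s_def)
  define c0 where "c0 = - 2 * Im \<kappa>"
  have ev1: "evalf F (x, 1) = c0 * h (x - p)" for x
    using arg_cong[OF ev[of x], of Re] by (simp add: c0_def)
  have ev2: "Re \<kappa> * h (x - p) = 0" for x
    using arg_cong[OF ev[of x], of Im] by simp
  have "\<sigma> * (a - p) = (a - b) * (a - d)" using assms(2) by (simp add: \<sigma>_def algebra_simps)
  then have \<sigma>0: "\<sigma> \<noteq> 0" using dist by auto
  have m0: "m \<noteq> 0" using dist assms(2) by (auto simp: m_def)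
  have "c0 \<noteq> 0"
  proof
    assume "c0 = 0"
    then have "Re \<kappa> \<noteq> 0" using \<kappa>(1) by (simp add: c0_def complex_eq_iff)
    then have h0: "h x = 0" for x using ev2[of "x + p"] by simp
    define e g where "e = (cmod \<sigma>)\<^sup>2" and "g = Re (\<sigma> * cnj m * \<sigma>)"
    have "h (\<i> * of_real t * \<sigma>) = t * g - t\<^sup>2 * e * (t * e + k)" for t
      unfolding h_def e_def g_def cmod_power2 by (simp add: algebra_simps power2_eq_square)
    from this[of 1] this[of "-1"] this[of 2] h0 have "g - e * (e + k) = 0" "- g - e * (k - e) = 0" "2 * g - 4 * e * (2 * e + k) = 0"
      by simp_all
    then have "e * e = 0" by (simp only: ring_distribs)
    then show False using \<sigma>0 by (simp add: e_def)
  qed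
  moreover have "evalf F v = c0 * ((cmod (fst v - of_real (snd v) * p))\<^sup>2 *
       (Im (\<sigma> * cnj (fst v - of_real (snd v) * p)) - k * snd v) +
       (snd v)\<^sup>2 * Im (\<sigma> * cnj m * (fst v - of_real (snd v) * p)))" for v
  proof -
    obtain z w where v: "v = (z, w)" by (cases v)
    define G where "G w = c0 * ((cmod (z - of_real w * p))\<^sup>2 *
       (Im (\<sigma> * cnj (z - of_real w * p)) - k * w) + w\<^sup>2 * Im (\<sigma> * cnj m * (z - of_real w * p)))" for w
    have eq: "evalf F (z, w) = G w" if "w \<noteq> 0" for w
    proof -
      define y where "y = z / of_real w - p"
      have z: "z - of_real w * p = of_real w * y" using that by (simp add: y_def field_simps)
      have "(z, w) = w *\<^sub>R (z / of_real w, 1)" using that by (simp add: scaleR_conv_of_real)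
      then have "evalf F (z, w) = w ^ 3 * (c0 * h y)"
        using evalf_homogeneous[OF hom, of w "(z / of_real w, 1)"] ev1 by (simp add: y_def)
      also have "\<dots> = G w" unfolding G_def z h_def cmod_power2
        by (simp add: algebra_simps power2_eq_square power3_eq_cube)
      finally show ?thesis .
    qed
    have "continuous_on UNIV (\<lambda>w. evalf F (z, w) - G w)"
      unfolding G_def by (intro continuous_intros continuous_on_compose2[OF continuous_evalf[of UNIV F]]) auto
    then have cont: "((\<lambda>w. evalf F (z, w) - G w) \<longlongrightarrow> evalf F (z, 0) - G 0) (at 0)"
      by (auto simp: continuous_on_eq_continuous_at isCont_def)
    moreover have "((\<lambda>w. evalf F (z, w) - G w) \<longlongrightarrow> 0) (at 0)"
      by (rule tendsto_eventually) (auto simp: eventually_at_filter eq)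
    ultimately have "evalf F (z, 0) - G 0 = 0" by (rule LIM_unique)
    then have "evalf F (z, w) = G w" using eq by (cases "w = 0") auto
    then show ?thesis by (simp add: v G_def)
  qed
  ultimately have "centered_cubic F p \<sigma> m k c0" using \<sigma>0 m0 by unfold_locales
  then show ?thesis using that by (simp add: \<sigma>_def m_def k_def s_def)
qed

subsection \<open>Points and tangents of the cubic\<close>

context centered_cubic
begin

definition dF :: "complex \<times> real \<Rightarrow> complex \<times> real \<Rightarrow> real" where
  "dF v y = (let \<zeta> = fst v - of_real (snd v) * p; \<eta> = fst y - of_real (snd y) * p in
     c0 * (2 * Re (\<zeta> * cnj \<eta>) * (Im (\<sigma> * cnj \<zeta>) - k * snd v) +
           (cmod \<zeta>)\<^sup>2 * (Im (\<sigma> * cnj \<eta>) - k * snd y) +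
           2 * snd v * snd y * Im (\<sigma> * cnj m * \<zeta>) + (snd v)\<^sup>2 * Im (\<sigma> * cnj m * \<eta>)))"

lemma frechet_derivative_evalf: "frechet_derivative (evalf F) (at v) = dF v"
proof (rule frechet_derivative_at[symmetric])
  define L where "L v = fst v - of_real (snd v) * p" for v
  have L: "(L has_derivative L) (at v)"
    unfolding L_def by (auto intro!: derivative_eq_intros)
  have lin: "((\<lambda>v. Re (L v)) has_derivative (\<lambda>y. Re (L y))) (at v)"
    "((\<lambda>v. Im (L v)) has_derivative (\<lambda>y. Im (L y))) (at v)"
    "((\<lambda>v. Im (\<sigma> * cnj (L v))) has_derivative (\<lambda>y. Im (\<sigma> * cnj (L y)))) (at v)"
    "((\<lambda>v. Im (\<sigma> * cnj m * L v)) has_derivative (\<lambda>y. Im (\<sigma> * cnj m * L y))) (at v)"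
    by (intro has_derivative_Re has_derivative_Im has_derivative_mult_right has_derivative_cnj L)+
  have eq: "evalf F = (\<lambda>v. c0 * ((Re (L v) * Re (L v) + Im (L v) * Im (L v)) *
       (Im (\<sigma> * cnj (L v)) - k * snd v) + (snd v * snd v) * Im (\<sigma> * cnj m * L v)))"
    unfolding fun_eq_iff evalf_eq cmod_power2 L_def by (simp only: power2_eq_square simp_thms)
  show "(evalf F has_derivative dF v) (at v)"
    unfolding eq dF_def Let_def L_def[symmetric] cmod_power2
    by (rule lin derivative_eq_intros refl)+
      (simp add: fun_eq_iff power2_eq_square algebra_simps)
qed

lemma dF_scale: "dF (t *\<^sub>R v) y = t\<^sup>2 * dF v y"
proof -
  have "fst (t *\<^sub>R v) - of_real (snd (t *\<^sub>R v)) * p = of_real t * (fst v - of_real (snd v) * p)"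
    by (simp add: scaleR_conv_of_real algebra_simps)
  then show ?thesis unfolding dF_def Let_def cmod_power2
    by (simp add: algebra_simps power2_eq_square)
qed

lemma tangent_line_pt:
  assumes "u \<noteq> 0"
  shows "tangent_line F (pt u) = {pt y | y. y \<noteq> 0 \<and> dF u y = 0}"
proof -
  have "dF u' y = 0 \<longleftrightarrow> dF u y = 0" if u': "u' \<noteq> 0" "pt u = pt u'" for u' y
  proof -
    obtain t where "t \<noteq> 0" "u' = t *\<^sub>R u" using u' pt_eq_iff[OF assms u'(1)] by blast
    then show ?thesis by (simp add: dF_scale)
  qed
  then show ?thesis unfolding tangent_line_def frechet_derivative_evalf using assms by blast
qed

lemma pt_in_curve:
  assumes "v \<noteq> 0"
  shows "pt v \<in> curve F \<longleftrightarrow> evalf F v = 0"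
proof -
  have scale: "evalf F (t *\<^sub>R v) = t ^ 3 * evalf F v" for t
  proof -
    have "fst (t *\<^sub>R v) - of_real (snd (t *\<^sub>R v)) * p = of_real t * (fst v - of_real (snd v) * p)"
      by (simp add: scaleR_conv_of_real algebra_simps)
    then show ?thesis unfolding evalf_eq cmod_power2
      by (simp add: algebra_simps power2_eq_square power3_eq_cube)
  qed
  have "evalf F u = 0 \<longleftrightarrow> evalf F v = 0" if u: "u \<noteq> 0" "pt v = pt u" for u
  proof -
    obtain t where "t \<noteq> 0" "u = t *\<^sub>R v" using u pt_eq_iff[OF assms u(1)] by blast
    then show ?thesis by (simp add: scale)
  qed
  then show ?thesis using assms unfolding curve_def by blast
qed

lemma fin_in_curve:
  assumes "x \<noteq> p"
  shows "fin x \<in> curve F \<longleftrightarrow> Im (\<sigma> * cnj ((x - p) + m / (x - p))) = k"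
proof -
  define \<xi> where "\<xi> = x - p"
  have \<xi>: "\<xi> \<noteq> 0" using assms by (simp add: \<xi>_def)
  have "cnj (\<xi> + m / \<xi>) * of_real ((cmod \<xi>)\<^sup>2) = cnj \<xi> * of_real ((cmod \<xi>)\<^sup>2) + cnj m * \<xi>"
    unfolding complex_norm_square using \<xi> by (simp add: field_simps)
  then have "\<sigma> * cnj (\<xi> + m / \<xi>) * of_real ((cmod \<xi>)\<^sup>2) = \<sigma> * cnj \<xi> * of_real ((cmod \<xi>)\<^sup>2) + \<sigma> * cnj m * \<xi>"
    by (metis (no_types, lifting) distrib_left mult.assoc)
  from arg_cong[OF this, of Im]
  have "Im (\<sigma> * cnj (\<xi> + m / \<xi>)) * (cmod \<xi>)\<^sup>2 = Im (\<sigma> * cnj \<xi>) * (cmod \<xi>)\<^sup>2 + Im (\<sigma> * cnj m * \<xi>)"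
    unfolding plus_complex.sel(2) times_complex.sel(2)[of _ "of_real r" for r] by simp
  then have "evalf F (x, 1) = c0 * (cmod \<xi>)\<^sup>2 * (Im (\<sigma> * cnj (\<xi> + m / \<xi>)) - k)"
    unfolding evalf_eq by (simp add: \<xi>_def[symmetric] algebra_simps del: times_complex.sel)
  then show ?thesis using c0 \<xi> pt_in_curve[of "(x, 1)"]
    by (simp add: fin_def zero_prod_def \<xi>_def)
qed

lemma infinity_in_curve:
  assumes "u \<noteq> 0" "pt (u, 0) \<in> curve F"
  shows "pt (u, 0) = pt (\<sigma>, 0)"
proof -
  have "Im (\<sigma> * cnj u) = 0"
    using assms pt_in_curve[of "(u, 0)"] c0 by (simp add: evalf_eq zero_prod_def)
  then obtain r where r: "\<sigma> / u = of_real r" unfolding Im_mult_cnj_eq_0_iff by (rule Reals_cases)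
  then have "r \<noteq> 0" "\<sigma> = r *\<^sub>R u" using \<sigma> assms(1) by (auto simp: scaleR_conv_of_real field_simps)
  then show ?thesis using pt_scale[of "(u, 0)" r] assms(1) by (simp add: zero_prod_def)
qed

lemma dF_fin:
  assumes "x \<noteq> p" "fin x \<in> curve F"
  shows "dF (x, 1) y = c0 * (cmod (x - p))\<^sup>2 *
    Im (\<sigma> * cnj ((fst y - of_real (snd y) * x) * (1 - m / (x - p)\<^sup>2)))"
proof -
  define \<xi> \<omega> \<delta> \<tau> where "\<xi> = x - p" and "\<omega> = snd y" and "\<delta> = fst y - of_real (snd y) * x"
    and "\<tau> = m / \<xi>\<^sup>2"
  have \<xi>: "\<xi> \<noteq> 0" using assms by (simp add: \<xi>_def)
  have \<eta>: "fst y - of_real (snd y) * p = \<delta> + of_real \<omega> * \<xi>"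
    by (simp add: \<delta>_def \<omega>_def \<xi>_def algebra_simps)
  have m: "m = \<tau> * \<xi>\<^sup>2" using \<xi> by (simp add: \<tau>_def)
  have k: "k = Im (\<sigma> * cnj (\<xi> + \<tau> * \<xi>))"
    using assms \<xi> unfolding fin_in_curve[OF assms(1)] \<tau>_def \<xi>_def by (simp add: power2_eq_square)
  have d: "dF (x, 1) y = c0 * (2 * Re (\<xi> * cnj (\<delta> + of_real \<omega> * \<xi>)) * (Im (\<sigma> * cnj \<xi>) - k) +
           (cmod \<xi>)\<^sup>2 * (Im (\<sigma> * cnj (\<delta> + of_real \<omega> * \<xi>)) - k * \<omega>) +
           2 * \<omega> * Im (\<sigma> * cnj m * \<xi>) + Im (\<sigma> * cnj m * (\<delta> + of_real \<omega> * \<xi>)))"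
    unfolding dF_def Let_def \<eta> by (simp add: \<xi>_def \<omega>_def)
  have "dF (x, 1) y = c0 * (cmod \<xi>)\<^sup>2 * Im (\<sigma> * cnj (\<delta> * (1 - \<tau>)))"
    unfolding d unfolding k m cmod_power2 mult.assoc[of c0]
    by (rule arg_cong[of _ _ "(*) c0"], simp add: power2_eq_square, algebra)
  then show ?thesis by (simp only: \<xi>_def \<tau>_def \<delta>_def)
qed

lemma tangent_line_fin:
  assumes "x \<noteq> p" "fin x \<in> curve F" "(x - p)\<^sup>2 \<noteq> m"
  shows "tangent_line F (fin x) = line_dir x (\<sigma> / (1 - m / (x - p)\<^sup>2))"
proof -
  define \<tau> where "\<tau> = 1 - m / (x - p)\<^sup>2"
  have \<tau>: "\<tau> \<noteq> 0" using assms by (simp add: \<tau>_def)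
  have "dF (x, 1) y = 0 \<longleftrightarrow> (fst y - of_real (snd y) * x) / (\<sigma> / \<tau>) \<in> \<real>" for y
  proof -
    let ?\<delta> = "fst y - of_real (snd y) * x"
    have "dF (x, 1) y = 0 \<longleftrightarrow> Im (\<sigma> * cnj (?\<delta> * \<tau>)) = 0"
      unfolding dF_fin[OF assms(1,2)] \<tau>_def using c0 assms(1) by simp
    also have "\<dots> \<longleftrightarrow> Im (cnj (\<sigma> * cnj (?\<delta> * \<tau>))) = 0"
      by (simp only: cnj.sel neg_equal_0_iff_equal)
    also have "cnj (\<sigma> * cnj (?\<delta> * \<tau>)) = ?\<delta> * \<tau> * cnj \<sigma>"
      by (simp add: mult_ac)
    finally show ?thesis unfolding Im_mult_cnj_eq_0_iff by simp
  qed
  then show ?thesis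
    using tangent_line_pt[of "(x, 1)"] by (simp add: fin_def zero_prod_def line_dir_def \<tau>_def)
qed

lemma singular_point_fin:
  assumes "x \<noteq> p" "fin x \<in> curve F" "(x - p)\<^sup>2 = m"
  shows "singular_point F (fin x)"
proof -
  have "dF (x, 1) = (\<lambda>_. 0)"
    using dF_fin[OF assms(1,2)] assms(1) by (simp add: assms(3)[symmetric] fun_eq_iff)
  then show ?thesis using assms(2) unfolding singular_point_def frechet_derivative_evalf
    by (intro conjI exI[of _ "(x, 1)"]) (auto simp: fin_def zero_prod_def)
qed

end

subsection \<open>Uniqueness of the isogonal conjugate\<close>

text \<open>If the four points are collinear, the cubic contains their line: in the coordinate
  \<open>\<xi> = (x - a) / u\<close> the quadratics have real coefficients, so \<open>Im \<xi>\<close> is a factor.\<close>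

lemma collinear_not_irreducible:
  assumes "isogonal_cubic_of a b c d F" "u \<noteq> 0" "(b - a) / u \<in> \<real>" "(c - a) / u \<in> \<real>" "(d - a) / u \<in> \<real>"
  shows "\<not> irreducible F"
proof
  assume irr: "irreducible F"
  obtain \<beta> \<gamma> \<delta> where "(b - a) / u = of_real \<beta>" "(c - a) / u = of_real \<gamma>" "(d - a) / u = of_real \<delta>"
    using assms(3-5) by (auto elim!: Reals_cases)
  then have bcd: "b = a + of_real \<beta> * u" "c = a + of_real \<gamma> * u" "d = a + of_real \<delta> * u"
    using assms(2) by (auto simp: field_simps)
  have hom: "homogeneous 3 F" using assms(1) by (auto simp: isogonal_cubic_of_def)
  obtain \<kappa> where \<kappa>: "\<And>x. complex_of_real (evalf F (x, 1)) =
     \<kappa> * ((x - b) * (x - d) * cnj ((x - a) * (x - c)) - cnj ((x - b) * (x - d)) * ((x - a) * (x - c)))"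
    using assms(1) unfolding isogonal_cubic_of_def by blast
  define s n where "s = \<gamma> - \<beta> - \<delta>" and "n = \<beta> * \<delta>"
  define c1 where "c1 = - 2 * Im \<kappa> * (cmod u) ^ 4"
  define q where "q \<xi> w = - s * (Re \<xi> * Re \<xi> + Im \<xi> * Im \<xi>) - 2 * n * w * Re \<xi> + n * \<gamma> * w * w" for \<xi> w
  have ev1: "evalf F (a + \<xi> * u, 1) = Im \<xi> * (c1 * q \<xi> 1)" for \<xi>
  proof -
    have "(\<xi> - \<beta>) * (\<xi> - \<delta>) * cnj (\<xi> * (\<xi> - \<gamma>)) - cnj ((\<xi> - \<beta>) * (\<xi> - \<delta>)) * (\<xi> * (\<xi> - \<gamma>))
       = \<i> * of_real (2 * (Im \<xi> * q \<xi> 1))"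
      by (simp add: complex_eq_iff q_def s_def n_def algebra_simps)
    then have "u\<^sup>2 * cnj (u\<^sup>2) * ((\<xi> - \<beta>) * (\<xi> - \<delta>) * cnj (\<xi> * (\<xi> - \<gamma>)) - cnj ((\<xi> - \<beta>) * (\<xi> - \<delta>)) * (\<xi> * (\<xi> - \<gamma>)))
       = of_real ((cmod u) ^ 4) * (\<i> * of_real (2 * (Im \<xi> * q \<xi> 1)))"
      by (simp only: complex_norm_square[symmetric] norm_power power_mult[symmetric]) simp
    moreover have "a + \<xi> * u - b = (\<xi> - \<beta>) * u" "a + \<xi> * u - d = (\<xi> - \<delta>) * u"
      "a + \<xi> * u - c = (\<xi> - \<gamma>) * u" "a + \<xi> * u - a = \<xi> * u"
      by (simp_all add: bcd algebra_simps)
    moreover have "(A * u) * (B * u) * cnj ((C * u) * (D * u)) - cnj ((A * u) * (B * u)) * ((C * u) * (D * u))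
        = u\<^sup>2 * cnj (u\<^sup>2) * (A * B * cnj (C * D) - cnj (A * B) * (C * D))" for A B C D
      by (simp add: power2_eq_square algebra_simps)
    ultimately have "complex_of_real (evalf F (a + \<xi> * u, 1)) = \<kappa> * (of_real ((cmod u) ^ 4) * (\<i> * of_real (2 * (Im \<xi> * q \<xi> 1))))"
      unfolding \<kappa> by (simp only:)
    from arg_cong[OF this, of Re] show ?thesis by (simp add: c1_def)
  qed
  let ?C = "\<lambda>r::real. [:[:[:r:]:]:]" and ?X = "[:[:[:0, 1:]:]:] :: form"
    and ?Y = "[:[:0, 1:]:] :: form" and ?W = "[:0, 1:] :: form"
  define v where "v = 1 / u"
  define G H where "G = (?X - ?C (Re a) * ?W) * ?C (Re v) - (?Y - ?C (Im a) * ?W) * ?C (Im v)"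
    and "H = (?X - ?C (Re a) * ?W) * ?C (Im v) + (?Y - ?C (Im a) * ?W) * ?C (Re v)"
  define Q where "Q = ?C c1 * (?C (- s) * (G * G + H * H) - ?C (2 * n) * ?W * G + ?C (n * \<gamma>) * ?W * ?W)"
  note evalf = evalf_add evalf_diff evalf_mult evalf_const evalf_x evalf_y evalf_w
  have G: "evalf G (z, w) = Re ((z - of_real w * a) * v)"
    and H: "evalf H (z, w) = Im ((z - of_real w * a) * v)" for z w
    unfolding G_def H_def evalf by (simp_all add: mult.commute)
  have Q: "evalf Q (z, w) = c1 * q ((z - of_real w * a) * v) w" for z w
    unfolding Q_def q_def evalf G H by simp
  have "evalf (F - H * Q) (z, w) = 0" if "w \<noteq> 0" for z w
  proof -
    define \<xi> where "\<xi> = (z / of_real w - a) * v"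
    have \<xi>: "(z - of_real w * a) * v = of_real w * \<xi>" using that by (simp add: \<xi>_def field_simps)
    have "(z, w) = w *\<^sub>R (a + \<xi> * u, 1)"
      using that assms(2) by (simp add: \<xi>_def v_def scaleR_conv_of_real)
    then have "evalf F (z, w) = w ^ 3 * (Im \<xi> * (c1 * q \<xi> 1))"
      using evalf_homogeneous[OF hom, of w "(a + \<xi> * u, 1)"] ev1 by simp
    then show ?thesis unfolding evalf H Q \<xi>
      by (simp add: q_def algebra_simps power3_eq_cube)
  qed
  then have "F - H * Q = 0" by (rule form_eq_0I)
  then have "F = H * Q" by simp
  moreover have "\<not> H dvd 1" by (rule not_unit_form[of _ "(a, 1)"]) (simp add: H)
  moreover have "\<not> Q dvd 1" by (rule not_unit_form[of _ "(0, 0)"]) (simp add: Q q_def)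
  ultimately show False using irreducibleD[OF irr] by blast
qed

context centered_cubic
begin

definition represents_conjugate_of :: "rp2 \<Rightarrow> complex \<times> real \<Rightarrow> bool" where
  "represents_conjugate_of X s \<longleftrightarrow> (\<exists>x. x \<noteq> p \<and> X = fin x \<and> s = (p + m / (x - p), 1)) \<or>
     X = fin p \<and> s = (\<sigma>, 0) \<or> X = pt (\<sigma>, 0) \<and> s = (p, 1)"

lemma conjugate_on_line:
  assumes v: "v \<noteq> p" "fin v \<in> curve F" "(v - p)\<^sup>2 \<noteq> m"
    and X: "X \<in> curve F" "represents_conjugate_of X s" and y: "y \<noteq> 0"
    and ef: "e \<noteq> 0" "f \<noteq> 0" "(e * f) / ((v - p) * \<sigma>) \<in> \<real>"
    and iso: "isogonal (fin v) (chord F (fin v) X) (chord F (fin v) (pt y)) (line_dir v e) (line_dir v f)"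
  shows "(fst y - of_real (snd y) * v) / (fst s - of_real (snd s) * v) \<in> \<real>"
proof (cases "fst y - of_real (snd y) * v = 0")
  case False
  define Y S \<nu> where "Y = fst y - of_real (snd y) * v" and "S = fst s - of_real (snd s) * v" and "\<nu> = v - p"
  have \<nu>: "\<nu> \<noteq> 0" using v by (simp add: \<nu>_def)
  have pv: "p - v = - \<nu>" by (simp add: \<nu>_def)
  have "Y \<noteq> 0" using False by (simp add: Y_def)
  have "pt y \<noteq> fin v"
  proof
    assume "pt y = fin v"
    then obtain t where "t \<noteq> 0" "(v, 1) = t *\<^sub>R y"
      using y pt_eq_iff[of y "(v, 1)"] by (auto simp: fin_def zero_prod_def)
    then have "of_real t * Y = 0" by (auto simp: Y_def prod_eq_iff scaleR_conv_of_real algebra_simps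
      simp flip: of_real_mult mult.assoc)
    then show False using \<open>t \<noteq> 0\<close> \<open>Y \<noteq> 0\<close> by simp
  qed
  then have chordY: "chord F (fin v) (pt y) = line_dir v Y"
    unfolding Y_def chord_def using line_through_fin[OF y False] by auto
  have key: "(U * Y) / (\<nu> * \<sigma>) \<in> \<real>" if U: "U \<noteq> 0" "chord F (fin v) X = line_dir v U" for U
  proof -
    have "(U * Y) / (e * f) \<in> \<real>"
      using iso unfolding chordY U(2) by (rule isogonal_line_dir) (use ef U(1) \<open>Y \<noteq> 0\<close> in auto)
    then have "(U * Y) / (e * f) * ((e * f) / (\<nu> * \<sigma>)) \<in> \<real>"
      using ef(3) unfolding \<nu>_def by (rule Reals_mult)
    then show ?thesis using ef by simp
  qed
  from X(2) consider (fin) x where "x \<noteq> p" "X = fin x" "s = (p + m / (x - p), 1)"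
    | (p) "X = fin p" "s = (\<sigma>, 0)" | (inf) "X = pt (\<sigma>, 0)" "s = (p, 1)"
    unfolding represents_conjugate_of_def by blast
  then have "Y / S \<in> \<real>"
  proof cases
    case p
    then have "chord F (fin v) X = line_dir v (p - v)"
      using v by (simp add: chord_def fin_inject line_through_fin_fin)
    then have "((p - v) * Y) / (\<nu> * \<sigma>) \<in> \<real>" using v by (intro key) auto
    moreover have "((p - v) * Y) / (\<nu> * \<sigma>) = - (Y / S)"
      using \<nu> p pv by (simp add: S_def)
    ultimately show ?thesis by (metis Reals_minus_iff)
  next
    case inf
    then have "chord F (fin v) X = line_dir v \<sigma>"
      using \<sigma> fin_neq_infinity by (simp add: chord_def line_through_fin_infinity)
    then have "(\<sigma> * Y) / (\<nu> * \<sigma>) \<in> \<real>" using \<sigma> by (intro key) auto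
    moreover have "(\<sigma> * Y) / (\<nu> * \<sigma>) = - (Y / S)"
      using \<nu> \<sigma> inf pv by (simp add: S_def)
    ultimately show ?thesis by (metis Reals_minus_iff)
  next
    case (fin x)
    show ?thesis
    proof (cases "x = v")
      case True
      define \<tau> where "\<tau> = 1 - m / \<nu>\<^sup>2"
      have \<tau>: "\<tau> \<noteq> 0" using v by (simp add: \<tau>_def \<nu>_def)
      have "chord F (fin v) X = line_dir v (\<sigma> / \<tau>)"
        using fin True tangent_line_fin[OF v] by (simp add: chord_def \<tau>_def \<nu>_def)
      then have "(\<sigma> / \<tau> * Y) / (\<nu> * \<sigma>) \<in> \<real>" using \<sigma> \<tau> by (intro key) auto
      moreover have "S = m / \<nu> - \<nu>" using fin True by (simp add: S_def \<nu>_def)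
      then have "S = - (\<nu> * \<tau>)" 
        using \<nu> unfolding \<tau>_def right_diff_distrib by (simp add: power2_eq_square)
      then have "(\<sigma> / \<tau> * Y) / (\<nu> * \<sigma>) = - (Y / S)"
        using \<nu> \<sigma> \<tau> by (simp add: field_simps)
      ultimately show ?thesis by (metis Reals_minus_iff)
    next
      case False
      then have "chord F (fin v) X = line_dir v (x - v)"
        using fin by (simp add: chord_def fin_inject line_through_fin_fin)
      then have 1: "((x - v) * Y) / (\<nu> * \<sigma>) \<in> \<real>" using False by (intro key) auto
      define \<xi> where "\<xi> = x - p"
      have \<xi>: "\<xi> \<noteq> 0" using fin by (simp add: \<xi>_def)
      define B where "B = (\<nu> + m / \<nu>) - (\<xi> + m / \<xi>)"
      have "Im (\<sigma> * cnj B) = Im (\<sigma> * cnj (\<nu> + m / \<nu>)) - Im (\<sigma> * cnj (\<xi> + m / \<xi>))"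
        unfolding B_def by (simp only: complex_cnj_diff right_diff_distrib minus_complex.sel)
      also have "\<dots> = 0"
        using v(2) X(1)[unfolded fin(2)] unfolding fin_in_curve[OF v(1)] fin_in_curve[OF fin(1)] \<nu>_def \<xi>_def
        by (simp only: diff_self)
      finally have "\<sigma> / B \<in> \<real>" unfolding Im_mult_cnj_eq_0_iff .
      then have "B / \<sigma> \<in> \<real>" by (metis Reals_inverse inverse_divide)
      moreover have xv: "x - v = \<xi> - \<nu>" and S: "S = m / \<xi> - \<nu>"
        using fin(3) by (simp_all add: S_def \<xi>_def \<nu>_def)
      have "(x - v) * S = \<nu> * B"
        unfolding xv S B_def using \<xi> \<nu> by (simp add: field_simps)
      then have "((x - v) * S) / (\<nu> * \<sigma>) = B / \<sigma>" using \<nu> by simp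
      ultimately have "((x - v) * Y) / (\<nu> * \<sigma>) / (((x - v) * S) / (\<nu> * \<sigma>)) \<in> \<real>"
        using Reals_divide[OF 1] by (simp only:)
      then show ?thesis using \<nu> \<sigma> False by simp
    qed
  qed
  then show ?thesis by (simp only: Y_def S_def)
qed simp

end

lemma conjugate_unique:
  assumes cub: "isogonal_cubic_of a b c d F" and cen: "(a - p) * (c - p) = (b - p) * (d - p)"
    and irr: "irreducible F"
    and cc: "centered_cubic F p (a + c - b - d) ((a - p) * (c - p)) (Im ((a + c - b - d) * cnj (a + c - 2 * p))) c0"
    and conj: "isogonal_conjugates_in a b c d F X X'" and X: "X \<in> curve F"
    and s: "centered_cubic.represents_conjugate_of p (a + c - b - d) ((a - p) * (c - p)) X s"
  shows "X' = pt s"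
proof -
  define \<sigma> where "\<sigma> = a + c - b - d"
  define m where "m = (a - p) * (c - p)"
  define k where "k = Im (\<sigma> * cnj (a + c - 2 * p))"
  interpret centered_cubic F p \<sigma> m k c0 using cc by (simp add: \<sigma>_def m_def k_def)
  have dist: "distinct [a, b, c, d]" using cub by (simp add: isogonal_cubic_of_def)
  have m': "m = (b - p) * (d - p)" using cen by (simp add: m_def)
  have ne: "a \<noteq> p" "b \<noteq> p" "c \<noteq> p" "d \<noteq> p" using m m_def m' by auto
  have s0: "represents_conjugate_of X s" using s by (simp add: \<sigma>_def m_def)
  have "s \<noteq> 0" using s0 \<sigma> by (auto simp: represents_conjugate_of_def zero_prod_def)
  obtain y where y: "y \<noteq> 0" "X' = pt y" by (rule pt_surj)
  have k': "k = Im (\<sigma> * cnj (b + d - 2 * p))"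
    unfolding k_def \<sigma>_def by (simp add: algebra_simps)
  have curve: "fin v \<in> curve F" "(v - p)\<^sup>2 \<noteq> m"
    if "v \<noteq> p" "v \<noteq> v'" "(v - p) * (v' - p) = m" "Im (\<sigma> * cnj (v + v' - 2 * p)) = k" for v v'
  proof -
    have eq: "(v - p) + m / (v - p) = v + v' - 2 * p"
      unfolding that(3)[symmetric] using that(1) by simp
    show "fin v \<in> curve F" unfolding fin_in_curve[OF that(1)] eq by (rule that(4))
    show "(v - p)\<^sup>2 \<noteq> m" unfolding that(3)[symmetric] power2_eq_square using that(1,2) by simp
  qed
  have vertex: "Im ((fst y - of_real (snd y) * v) * cnj (fst s - of_real (snd s) * v)) = 0"
    if "v \<noteq> p" "v \<noteq> v'" "(v - p) * (v' - p) = m" "Im (\<sigma> * cnj (v + v' - 2 * p)) = k"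
      "e \<noteq> v" "f \<noteq> v" "(e - v) * (f - v) = r * ((v - p) * \<sigma>)" "r \<in> \<real>"
      "isogonal (fin v) (chord F (fin v) X) (chord F (fin v) X')
         (line_through (fin v) (fin e)) (line_through (fin v) (fin f))" for v v' e f r
  proof -
    have "(e - v) * (f - v) / ((v - p) * \<sigma>) = r" using that \<sigma> by simp
    then show ?thesis
      unfolding Im_mult_cnj_eq_0_iff
      using that curve[OF that(1-4)] X s0 y
      by (intro conjugate_on_line[of v X s y "e - v" "f - v"]) (simp_all add: line_through_fin_fin)
  qed
  note conj' = conj[unfolded isogonal_conjugates_in_def]
  have va: "Im ((fst y - of_real (snd y) * a) * cnj (fst s - of_real (snd s) * a)) = 0"
    by (rule vertex[of a c b d 1])
      (use ne dist conj' m' in \<open>auto simp: m_def k_def \<sigma>_def algebra_simps\<close>)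
  have vb: "Im ((fst y - of_real (snd y) * b) * cnj (fst s - of_real (snd s) * b)) = 0"
    by (rule vertex[of b d c a "-1"])
      (use ne dist conj' m_def in \<open>auto simp: m' k' \<sigma>_def algebra_simps\<close>)
  have vc: "Im ((fst y - of_real (snd y) * c) * cnj (fst s - of_real (snd s) * c)) = 0"
    by (rule vertex[of c a d b 1])
      (use ne dist conj' m' in \<open>auto simp: m_def k_def \<sigma>_def algebra_simps\<close>)
  have vd: "Im ((fst y - of_real (snd y) * d) * cnj (fst s - of_real (snd s) * d)) = 0"
    by (rule vertex[of d b a c "-1"])
      (use ne dist conj' m_def in \<open>auto simp: m' k' \<sigma>_def algebra_simps\<close>)
  obtain z w where zw: "y = (z, w)" by (cases y)
  obtain z' w' where zw': "s = (z', w')" by (cases s)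
  define u where "u = of_real w' * z - of_real w * z'"
  \<comment> \<open>the determinant of \<open>(v, 1)\<close>, \<open>y\<close>, \<open>s\<close>; if \<open>y\<close> and \<open>s\<close> are independent, its vanishing at
    all vertices puts them on one line\<close>
  have det: "Im ((z - of_real w * v) * cnj (z' - of_real w' * v)) = Im (z * cnj z') + Im (v * cnj u)" for v
    by (simp add: u_def algebra_simps)
  have "u = 0"
  proof (rule ccontr)
    assume "u \<noteq> 0"
    have "(v - a) / u \<in> \<real>" if "Im (z * cnj z') + Im (v * cnj u) = 0" for v
    proof -
      have "Im ((v - a) * cnj u) = 0"
        using that va[unfolded zw zw' fst_conv snd_conv det] by (simp add: algebra_simps)
      then show ?thesis unfolding Im_mult_cnj_eq_0_iff .
    qed
    then have "\<not> irreducible F"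
      using vb vc vd unfolding zw zw' fst_conv snd_conv det
      by (intro collinear_not_irreducible[OF cub \<open>u \<noteq> 0\<close>])
    then show False using irr by simp
  qed
  then have par: "Im (z * cnj z') = 0" "of_real w' * z = of_real w * z'"
    using va[unfolded zw zw' fst_conv snd_conv det] by (auto simp: u_def)
  have "\<exists>t. y = t *\<^sub>R s"
  proof (cases "w' = 0")
    case False
    then have "y = (w / w') *\<^sub>R s" using par(2)
      by (simp add: zw zw' scaleR_conv_of_real field_simps)
    then show ?thesis ..
  next
    case True
    then have "z' \<noteq> 0" using \<open>s \<noteq> 0\<close> by (simp add: zw' zero_prod_def)
    moreover obtain t where "z / z' = of_real t"
      using par(1) unfolding Im_mult_cnj_eq_0_iff by (rule Reals_cases)
    ultimately have "y = t *\<^sub>R s" using True par(2)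
      by (simp add: zw zw' scaleR_conv_of_real field_simps)
    then show ?thesis ..
  qed
  then obtain t where "y = t *\<^sub>R s" ..
  moreover from this have "t \<noteq> 0" using y(1) by auto
  ultimately show ?thesis using y(2) pt_scale[OF \<open>s \<noteq> 0\<close>] by (simp only:)
qed

subsection \<open>The tangent\<close>

theorem theorem7p3:
  fixes F :: form and P Pinf X X' :: rp2 and l :: "rp2 set"
  assumes "isogonal_cubic F"
    and "irreducible F"
    and "spiral_center F P"
    and "Pinf \<in> curve F" and "Pinf \<in> line_at_infinity"
    and "X \<in> curve F" and "\<not> singular_point F X"
    and "isogonal_conjugates F X X'"
    and "isogonal X (chord F X X') l (chord F X P) (chord F X Pinf)"
  shows "l = tangent_line F X"
proof -
  obtain a b c d where cub: "isogonal_cubic_of a b c d F" and conj: "isogonal_conjugates_in a b c d F X X'"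
    using assms(8) by (auto simp: isogonal_conjugates_def)
  obtain p where P: "P = fin p" using assms(3) by (auto simp: spiral_center_def)
  then have cen: "(a - p) * (c - p) = (b - p) * (d - p)"
    using spiral_center_unique[OF cub] assms(3) by simp
  define \<sigma> where "\<sigma> = a + c - b - d"
  define m where "m = (a - p) * (c - p)"
  obtain c0 where cc: "centered_cubic F p (a + c - b - d) ((a - p) * (c - p))
      (Im ((a + c - b - d) * cnj (a + c - 2 * p))) c0"
    using centered_cubicI[OF cub cen] by blast
  interpret centered_cubic F p \<sigma> m "Im (\<sigma> * cnj (a + c - 2 * p))" c0
    using cc by (simp add: \<sigma>_def m_def)
  have X': "X' = pt s" if "represents_conjugate_of X s" for s
    using conjugate_unique[OF cub cen assms(2) cc conj assms(6)] that by (simp add: \<sigma>_def m_def)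
  have Pinf: "Pinf = pt (\<sigma>, 0)"
    using assms(4,5) infinity_in_curve by (auto simp: line_at_infinity_def)
  have lines: "is_line k" "k \<noteq> line_at_infinity" "X \<in> k"
    if "k \<in> {chord F X X', l, chord F X P, chord F X Pinf}" for k
    using assms(9) that unfolding isogonal_def by blast+
  show ?thesis
  proof (cases X rule: rp2_cases)
    case (1 x)
    obtain t where t: "t \<noteq> 0" "l = line_dir x t" using is_line_fin lines[of l] 1 by blast
    have Xinf: "chord F X Pinf = line_dir x \<sigma>"
      using \<sigma> fin_neq_infinity by (simp add: chord_def 1 Pinf line_through_fin_infinity)
    show ?thesis
    proof (cases "x = p")
      case True
      then have "X' = Pinf" using X'[of "(\<sigma>, 0)"] by (simp add: represents_conjugate_of_def 1 Pinf)
      then have XX': "chord F X X' = line_dir x \<sigma>" using Xinf by simp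
      have XP: "chord F X P = tangent_line F X" by (simp add: chord_def 1 P True)
      then obtain t' where t': "t' \<noteq> 0" "tangent_line F X = line_dir x t'"
        using is_line_fin lines[of "chord F X P"] 1 by (metis insertCI)
      have "(\<sigma> * t) / (t' * \<sigma>) \<in> \<real>"
        using assms(9) unfolding Xinf XX' XP t'(2) t(2) unfolding 1
        by (rule isogonal_line_dir) (use \<sigma> t t' in auto)
      then have "t / t' \<in> \<real>" using \<sigma> by simp
      then show ?thesis using t t' line_dir_cong by simp
    next
      case False
      define \<xi> where "\<xi> = x - p"
      define \<tau> where "\<tau> = 1 - m / \<xi>\<^sup>2"
      have \<xi>: "\<xi> \<noteq> 0" using False by (simp add: \<xi>_def)
      have ns: "(x - p)\<^sup>2 \<noteq> m" using singular_point_fin False assms(6,7) 1 by blast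
      then have \<tau>: "\<tau> \<noteq> 0" using \<xi> by (simp add: \<tau>_def \<xi>_def)
      define x' where "x' = p + m / \<xi>"
      have "X' = fin x'"
        using X'[of "(x', 1)"] False 1 unfolding represents_conjugate_of_def fin_def[of x'] unfolding x'_def \<xi>_def by blast
      moreover have d: "x' - x = - (\<xi> * \<tau>)"
        using \<xi> by (simp add: x'_def \<tau>_def field_simps power2_eq_square) (simp add: \<xi>_def algebra_simps)
      then have "x' \<noteq> x" using \<xi> \<tau> by auto
      ultimately have XX': "chord F X X' = line_dir x (x' - x)"
        by (simp add: chord_def 1 fin_inject line_through_fin_fin)
      have XP: "chord F X P = line_dir x (p - x)"
        using False by (simp add: chord_def 1 P fin_inject line_through_fin_fin)
      have "((x' - x) * t) / ((p - x) * \<sigma>) \<in> \<real>"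
        using assms(9) unfolding Xinf XX' XP t(2) unfolding 1
        by (rule isogonal_line_dir) (use \<sigma> t False \<open>x' \<noteq> x\<close> in auto)
      moreover have "p - x = - \<xi>" by (simp add: \<xi>_def)
      ultimately have "t / (\<sigma> / \<tau>) \<in> \<real>" unfolding d using \<xi> by (simp add: mult.commute)
      then have "l = line_dir x (\<sigma> / \<tau>)" using t \<sigma> \<tau> line_dir_cong by simp
      then show ?thesis using tangent_line_fin[OF False _ ns] assms(6) by (simp add: 1 \<tau>_def \<xi>_def)
    qed
  next
    case (2 u)
    then have X: "X = pt (\<sigma>, 0)" using infinity_in_curve assms(6) by simp
    then have "X' = P" using X'[of "(p, 1)"] by (simp add: represents_conjugate_of_def P fin_def)
    moreover have XP: "chord F X P = line_dir p \<sigma>"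
      using fin_neq_infinity[OF \<sigma>, of p] \<sigma>
      by (auto simp: chord_def X P line_through_commute[of _ "fin p"] line_through_fin_infinity)
    ultimately have XX': "chord F X X' = line_dir p \<sigma>" by simp
    have Xinf: "chord F X Pinf = tangent_line F X" by (simp add: chord_def X Pinf)
    obtain e where e: "l = line_dir e \<sigma>"
      using is_line_infinity[OF lines(1,2)[of l]] lines(3)[of l] X \<sigma> by auto
    obtain f where f: "tangent_line F X = line_dir f \<sigma>"
      using is_line_infinity[OF lines(1,2)[of "tangent_line F X"]] lines(3)[of "tangent_line F X"] X \<sigma> Xinf by auto
    have "midline (line_dir p \<sigma>) (line_dir e \<sigma>) = midline (line_dir p \<sigma>) (line_dir f \<sigma>)"
      using assms(9) fin_neq_infinity[OF \<sigma>]
      unfolding isogonal_def XX' XP Xinf e f unfolding X by metis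
    then show ?thesis unfolding e f using \<sigma> by (rule midline_cancel)
  qed
qed

end
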